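(* If $\mathrm{BallCenterBundle}$ holds, then for every name $P$ with $\eta\,P\,\mathrm{balls}$, $\mathrm{GPointOpen}(\mathrm{GPointSingle}(P))$ does not hold.
   Context: Logic is classical. Names form a type $N$; a name may designate zero, one or several objects. The relation $\eta : N\to N\to \mathrm{Prop}$ (singular inclusion) is governed by Leśniewski's Ontology: $\eta\,A\,b$ holds iff [there is $C$ with $\eta\,C\,A$] and [for all $C,D$, $\eta\,C\,A$ and $\eta\,D\,A$ imply $\eta\,C\,D$] and [for all $C$, $\eta\,C\,A$ implies $\eta\,C\,b$]; i.e. $A$ designates exactly one object, which is among those designated by $b$. $A$ is an Individual iff $\eta\,A\,A$. Notation: $P\equiv Q$ iff $\eta\,P\,Q$ and $\eta\,Q\,P$; $a\approx b$ iff $\forall P,\ \eta\,P\,a\leftrightarrow\eta\,P\,b$. Names with the same extension are interchangeable. Name-forming operators are introduced by stating when $\eta\,P\,(\cdot)$ holds. Mereology: $\eta\,P\,(\mathrm{pt}(Q))$ ("$P$ is a part of $Q$") relates individuals and is reflexive on individuals, transitive, and antisymmetric up to $\equiv$; a proper part of $Q$ is a part $P$ with not $P\equiv Q$; $\eta\,P\,(\mathrm{ext}(Q))$ ("$P$ is external to $Q$") means $P,Q$ are individuals with no common part. Geometry: $\mathrm{balls}$ is a primitive name whose members are individuals (balls); at least one ball exists. $\eta\,P\,(\mathrm{Concent}(Q))$ means that the balls $P,Q$ are concentric in Tarski's sense: $P\equiv Q$; or $P$ is a proper part of $Q$ and any two balls $X,Y$ externally diametrical to $P$ and internally tangent to $Q$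 are internally diametrical to $Q$; or the same with $P,Q$ exchanged. Here (all variables balls): $A$ is externally tangent to $B$ if $A$ is external to $B$ and of any two balls $X,Y$ having $A$ as part and external to $B$ one is part of the other; $A$ is internally tangent to $B$ if $A$ is a proper part of $B$ and of any two balls $X,Y$ having $A$ as part and being parts of $B$ one is part of the other; $A,B$ are externally diametrical to $C$ if both are externally tangent to $C$ and whenever $X,Y$ are external to $C$, $A$ is part of $X$ and $B$ is part of $Y$, then $X$ is external to $Y$; $A,B$ are internally diametrical to $C$ if both are internally tangent to $C$ and whenever $X,Y$ are external to $C$, $A$ is externally tangent to $X$ and $B$ to $Y$, then $X$ is external to $Y$. $\eta\,P\,(\mathrm{Point}(Q))$ iff $\eta\,P\,\mathrm{balls}$, $\eta\,Q\,\mathrm{balls}$ and $\eta\,P\,(\mathrm{Concent}(Q))$. Standing assumptions: concentricity is an equivalence relation on balls, and concentric balls $P,Q$ satisfy $\mathrm{Point}(P)\approx\mathrm{Point}(Q)$. Point-class notions: $\mathrm{same\_center}(P,Q)$ iff $\mathrm{Point}(P)\approx\mathrm{Point}(Q)$. $\mathrm{PointSet\_incl}(u,v)$ iff for all $B$ with $\eta\,B\,\mathrm{balls}$, $\eta\,B\,u$ implies $\eta\,B\,v$. $\mathrm{PointSet\_stable}(u)$ iff for all $B,C$, $\mathrm{same\_center}(B,C)$ and $\eta\,B\,u$ imply $\eta\,C\,u$. $\eta\,P\,\mathrm{PointClassInterior}(q)$ iff $\eta\,P\,\mathrm{balls}$ and there is $C$ with $\eta\,C\,\mathrm{balls}$,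 $\mathrm{same\_center}(P,C)$ and $\eta\,C\,q$. $\mathrm{GPointSingle}(P)=\mathrm{PointClassInterior}(\mathrm{Point}(P))$. $\eta\,P\,\mathrm{GBasicPointSet}(Q)$ iff $\eta\,Q\,\mathrm{balls}$, $\eta\,P\,\mathrm{balls}$ and there is $C$ with $\eta\,C\,\mathrm{balls}$, $\mathrm{same\_center}(P,C)$ and $\eta\,C\,(\mathrm{pt}(Q))$. $\mathrm{GPointOpen}(u)$ iff $\mathrm{PointSet\_stable}(u)$; and every $P$ with $\eta\,P\,u$ satisfies $\eta\,P\,\mathrm{balls}$; and for every $P$ with $\eta\,P\,u$ there is $Q$ with $\eta\,Q\,\mathrm{balls}$, $\eta\,P\,\mathrm{GBasicPointSet}(Q)$ and $\mathrm{PointSet\_incl}(\mathrm{GBasicPointSet}(Q),u)$. $\mathrm{BallCenterBundle}$ is the proposition: for every $B$ with $\eta\,B\,\mathrm{balls}$ there is $C$ with $\eta\,C\,\mathrm{balls}$, $\eta\,C\,(\mathrm{pt}(B))$ and not $\mathrm{same\_center}(C,B)$. *)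

theory Defs
  imports Main
begin

text \<open>
  Names form a type \<open>'n\<close>. Name-forming operators are not available in HOL for free: that there is a
  name with a prescribed extension is part of the theory. They are therefore locale parameters
  (functions from names to names) characterised by stating when \<open>eta P (op Q)\<close> holds.
  Relations and conditions on names are ordinary HOL predicates.
\<close>

locale ontology =
  fixes eta :: "'n \<Rightarrow> 'n \<Rightarrow> bool"
  assumes eta_iff:
    "eta A b \<longleftrightarrow>
      (\<exists>C. eta C A) \<and>
      (\<forall>C D. eta C A \<and> eta D A \<longrightarrow> eta C D) \<and>
      (\<forall>C. eta C A \<longrightarrow> eta C b)"
    \<comment> \<open>Interchangeability of coextensive names in every context is equality in HOL.\<close>
    and extensionality: "(\<forall>P. eta P a \<longleftrightarrow> eta P b) \<Longrightarrow> a = b"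
begin

definition Individual :: "'n \<Rightarrow> bool" where
  "Individual A \<longleftrightarrow> eta A A"

definition identical :: "'n \<Rightarrow> 'n \<Rightarrow> bool" where
  "identical P Q \<longleftrightarrow> eta P Q \<and> eta Q P"

definition coextensive :: "'n \<Rightarrow> 'n \<Rightarrow> bool" where
  "coextensive a b \<longleftrightarrow> (\<forall>P. eta P a \<longleftrightarrow> eta P b)"

end

locale mereology = ontology eta
  for eta :: "'n \<Rightarrow> 'n \<Rightarrow> bool" +
  fixes pt :: "'n \<Rightarrow> 'n"
    and ext :: "'n \<Rightarrow> 'n"
  assumes pt_Individual: "eta P (pt Q) \<Longrightarrow> Individual P \<and> Individual Q"
    and pt_refl: "Individual P \<Longrightarrow> eta P (pt P)"
    and pt_trans: "eta P (pt Q) \<Longrightarrow> eta Q (pt R) \<Longrightarrow> eta P (pt R)"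
    and pt_antisym: "eta P (pt Q) \<Longrightarrow> eta Q (pt P) \<Longrightarrow> identical P Q"
    and eta_ext:
      "eta P (ext Q) \<longleftrightarrow>
        Individual P \<and> Individual Q \<and> \<not> (\<exists>R. eta R (pt P) \<and> eta R (pt Q))"
begin

definition proper_part :: "'n \<Rightarrow> 'n \<Rightarrow> bool" where
  "proper_part P Q \<longleftrightarrow> eta P (pt Q) \<and> \<not> identical P Q"

end

locale ball_mereology = mereology eta pt ext
  for eta :: "'n \<Rightarrow> 'n \<Rightarrow> bool" and pt ext :: "'n \<Rightarrow> 'n" +
  fixes balls :: 'n
  assumes balls_Individual: "eta B balls \<Longrightarrow> Individual B"
    and balls_nonempty: "\<exists>B. eta B balls"
begin

definition externally_tangent :: "'n \<Rightarrow> 'n \<Rightarrow> bool" where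
  "externally_tangent A B \<longleftrightarrow>
    eta A balls \<and> eta B balls \<and> eta A (ext B) \<and>
    (\<forall>X Y. eta X balls \<and> eta Y balls \<and>
           eta A (pt X) \<and> eta X (ext B) \<and> eta A (pt Y) \<and> eta Y (ext B) \<longrightarrow>
           eta X (pt Y) \<or> eta Y (pt X))"

definition internally_tangent :: "'n \<Rightarrow> 'n \<Rightarrow> bool" where
  "internally_tangent A B \<longleftrightarrow>
    eta A balls \<and> eta B balls \<and> proper_part A B \<and>
    (\<forall>X Y. eta X balls \<and> eta Y balls \<and>
           eta A (pt X) \<and> eta X (pt B) \<and> eta A (pt Y) \<and> eta Y (pt B) \<longrightarrow>
           eta X (pt Y) \<or> eta Y (pt X))"

definition externally_diametrical :: "'n \<Rightarrow> 'n \<Rightarrow> 'n \<Rightarrow> bool" where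
  "externally_diametrical A B C \<longleftrightarrow>
    externally_tangent A C \<and> externally_tangent B C \<and>
    (\<forall>X Y. eta X balls \<and> eta Y balls \<and>
           eta X (ext C) \<and> eta Y (ext C) \<and> eta A (pt X) \<and> eta B (pt Y) \<longrightarrow>
           eta X (ext Y))"

definition internally_diametrical :: "'n \<Rightarrow> 'n \<Rightarrow> 'n \<Rightarrow> bool" where
  "internally_diametrical A B C \<longleftrightarrow>
    internally_tangent A C \<and> internally_tangent B C \<and>
    (\<forall>X Y. eta X balls \<and> eta Y balls \<and>
           eta X (ext C) \<and> eta Y (ext C) \<and>
           externally_tangent A X \<and> externally_tangent B Y \<longrightarrow>
           eta X (ext Y))"

definition inner_concentric :: "'n \<Rightarrow> 'n \<Rightarrow> bool" where
  "inner_concentric P Q \<longleftrightarrow>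
    proper_part P Q \<and>
    (\<forall>X Y. eta X balls \<and> eta Y balls \<and>
           externally_diametrical X Y P \<and>
           internally_tangent X Q \<and> internally_tangent Y Q \<longrightarrow>
           internally_diametrical X Y Q)"

end

locale ball_geometry = ball_mereology eta pt ext balls
  for eta :: "'n \<Rightarrow> 'n \<Rightarrow> bool" and pt ext :: "'n \<Rightarrow> 'n" and balls :: 'n +
  fixes Concent :: "'n \<Rightarrow> 'n"
    and Point :: "'n \<Rightarrow> 'n"
  assumes eta_Concent:
      "eta P (Concent Q) \<longleftrightarrow>
        eta P balls \<and> eta Q balls \<and>
        (identical P Q \<or> inner_concentric P Q \<or> inner_concentric Q P)"
    and Concent_equiv: "equiv {B. eta B balls} {(P, Q). eta P (Concent Q)}"
    and eta_Point:
      "eta P (Point Q) \<longleftrightarrow> eta P balls \<and> eta Q balls \<and> eta P (Concent Q)"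
    and Point_Concent: "eta P (Concent Q) \<Longrightarrow> coextensive (Point P) (Point Q)"
begin

definition same_center :: "'n \<Rightarrow> 'n \<Rightarrow> bool" where
  "same_center P Q \<longleftrightarrow> coextensive (Point P) (Point Q)"

end

locale point_class_geometry = ball_geometry eta pt ext balls Concent Point
  for eta :: "'n \<Rightarrow> 'n \<Rightarrow> bool" and pt ext :: "'n \<Rightarrow> 'n" and balls :: 'n
    and Concent Point :: "'n \<Rightarrow> 'n" +
  fixes PointClassInterior :: "'n \<Rightarrow> 'n"
    and GBasicPointSet :: "'n \<Rightarrow> 'n"
  assumes eta_PointClassInterior:
      "eta P (PointClassInterior q) \<longleftrightarrow>
        eta P balls \<and> (\<exists>C. eta C balls \<and> same_center P C \<and> eta C q)"
    and eta_GBasicPointSet: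
      "eta P (GBasicPointSet Q) \<longleftrightarrow>
        eta Q balls \<and> eta P balls \<and>
        (\<exists>C. eta C balls \<and> same_center P C \<and> eta C (pt Q))"
begin

definition GPointSingle :: "'n \<Rightarrow> 'n" where
  "GPointSingle P = PointClassInterior (Point P)"

definition PointSet_incl :: "'n \<Rightarrow> 'n \<Rightarrow> bool" where
  "PointSet_incl u v \<longleftrightarrow> (\<forall>B. eta B balls \<longrightarrow> eta B u \<longrightarrow> eta B v)"

definition PointSet_stable :: "'n \<Rightarrow> bool" where
  "PointSet_stable u \<longleftrightarrow> (\<forall>B C. same_center B C \<longrightarrow> eta B u \<longrightarrow> eta C u)"

definition GPointOpen :: "'n \<Rightarrow> bool" where
  "GPointOpen u \<longleftrightarrow>
    PointSet_stable u \<and>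
    (\<forall>P. eta P u \<longrightarrow> eta P balls) \<and>
    (\<forall>P. eta P u \<longrightarrow>
      (\<exists>Q. eta Q balls \<and> eta P (GBasicPointSet Q) \<and> PointSet_incl (GBasicPointSet Q) u))"

definition BallCenterBundle :: bool where
  "BallCenterBundle \<longleftrightarrow>
    (\<forall>B. eta B balls \<longrightarrow>
      (\<exists>C. eta C balls \<and> eta C (pt B) \<and> \<not> same_center C B))"

end

end

theory Submission
  imports Defs
begin

text \<open>
  The point of a ball \<open>P\<close>, read as a point class, contains only balls with the center of \<open>P\<close>
  (\<open>eta_GPointSingle_iff\<close>). Were it open, some basic set around a ball \<open>Q\<close> would be included in it.
  Such a basic set contains every ball that is part of \<open>Q\<close> (\<open>ball_part_in_GBasicPointSet\<close>): \<open>Q\<close>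
  itself, and also the off-center ball inside \<open>Q\<close> that the bundle condition provides. Both would
  then share the center of \<open>P\<close>, hence each other's center, against the choice of the second ball.
\<close>

context point_class_geometry
begin

lemma same_center_refl: "same_center A A"
  by (simp add: same_center_def coextensive_def)

lemma same_center_sym: "same_center A B \<Longrightarrow> same_center B A"
  by (simp add: same_center_def coextensive_def)

lemma same_center_trans: "same_center A B \<Longrightarrow> same_center B C \<Longrightarrow> same_center A C"
  by (simp add: same_center_def coextensive_def)

lemma Point_same_center: "eta A (Point P) \<Longrightarrow> same_center A P"
  using eta_Point Point_Concent by (simp add: same_center_def)

lemma ball_in_own_Point:
  assumes "eta P balls"
  shows "eta P (Point P)"
  using assms Concent_equiv eta_Point by (auto simp: equiv_def refl_on_def)

lemma eta_GPointSingle_iff: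
  assumes "eta P balls"
  shows "eta A (GPointSingle P) \<longleftrightarrow> eta A balls \<and> same_center A P"
  unfolding GPointSingle_def eta_PointClassInterior
  using assms ball_in_own_Point Point_same_center same_center_trans by blast

lemma ball_part_in_GBasicPointSet:
  assumes "eta Q balls" "eta C balls" "eta C (pt Q)"
  shows "eta C (GBasicPointSet Q)"
  using assms same_center_refl eta_GBasicPointSet by blast

lemma not_GPointOpen_GPointSingle:
  assumes off_center_part: BallCenterBundle and P: "eta P balls"
  shows "\<not> GPointOpen (GPointSingle P)"
proof
  assume "GPointOpen (GPointSingle P)"
  moreover have "eta P (GPointSingle P)"
    using P same_center_refl by (simp add: eta_GPointSingle_iff)
  ultimately obtain Q where Q: "eta Q balls"
    and incl: "PointSet_incl (GBasicPointSet Q) (GPointSingle P)"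
    unfolding GPointOpen_def by blast
  have centered: "same_center C P" if "eta C balls" "eta C (pt Q)" for C
    using that ball_part_in_GBasicPointSet[OF Q] incl eta_GPointSingle_iff[OF P]
    unfolding PointSet_incl_def by blast
  obtain C where C: "eta C balls" "eta C (pt Q)" and off_center: "\<not> same_center C Q"
    using off_center_part Q unfolding BallCenterBundle_def by blast
  have "same_center Q P"
    using centered Q balls_Individual pt_refl by blast
  with centered[OF C] have "same_center C Q"
    using same_center_sym same_center_trans by blast
  with off_center show False ..
qed

end

theorem theorem19:
  fixes eta :: "'n \<Rightarrow> 'n \<Rightarrow> bool"
    and pt ext Concent Point PointClassInterior GBasicPointSet :: "'n \<Rightarrow> 'n"
    and balls :: 'n
  assumes "point_class_geometry eta pt ext balls Concent Point PointClassInterior GBasicPointSet"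
    and "point_class_geometry.BallCenterBundle eta pt balls Point"
  shows "\<forall>P. eta P balls \<longrightarrow>
    \<not> point_class_geometry.GPointOpen eta balls Point GBasicPointSet
        (point_class_geometry.GPointSingle Point PointClassInterior P)"
  using point_class_geometry.not_GPointOpen_GPointSingle[OF assms] by blast

end
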